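(* Let $(\alpha,\beta)$ belong to $\mathcal{D} = \{(\alpha,\beta) : \alpha/2 \leqslant \beta \leqslant \alpha^2,\ 1/2 \leqslant \alpha \leqslant 1\} \setminus \{(1,1)\}$. Then every $(\alpha,\beta)$-grandchildren-balanced tree with $\mathbf{N}$ nodes has external path length $\lambda \leqslant (\mathbf{N}+1)\log_2(\mathbf{N}+1)/\Delta$, where $\Delta = (\mathsf{H}_2(\alpha) + \alpha\,\mathsf{H}_2(\beta/\alpha))/(1+\alpha)$ and $\mathsf{H}_2(x) = -x\log_2(x) - (1-x)\log_2(1-x)$.
   Context: Binary trees are considered. The weight $|\mathcal{T}|$ of a binary tree $\mathcal{T}$ is its number of empty sub-trees (equivalently, its number of nodes plus one); the weight $|n|$ of a node $n$ is the weight of the sub-tree rooted at $n$. By convention, each empty tree (weight $1$) is viewed as an infinite complete binary tree whose nodes at depth $d$ have weight $2^{-d}$, so that every node formally has two children and four grandchildren. For a node $n$ with children $n_1,n_2$ and grandchildren $n_{11},n_{12},n_{21},n_{22}$, define $\mathsf{bal_C}(n)=\max\{|n_1|,|n_2|\}/|n|$ and $\mathsf{bal_{GC}}(n)=\max\{|n_{11}|,|n_{12}|,|n_{21}|,|n_{22}|\}/|n|$. The node $n$ is $(\alpha,\beta)$-balanced if $\mathsf{bal_C}(n)\leqslant\alpha$ and $\mathsf{bal_{GC}}(n)\leqslant\beta$. A tree is $(\alpha,\beta)$-grandchildren-balanced if all its nodes are $(\alpha,\beta)$-balanced. The external path length of a tree is the sum, over all empty sub-trees of the tree, of the lengths of the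 paths from the root to these empty sub-trees. *)

theory Defs
  imports Complex_Main "HOL-Library.Tree"
begin

text \<open>
  The weight of a tree is \<^const>\<open>size1\<close>, its number of empty sub-trees.
  An empty tree is viewed as an infinite complete binary tree whose nodes at depth \<open>d\<close> have
  weight \<open>1 / 2 ^ d\<close>. Below, \<open>node_weight t p\<close> is the weight of the possibly virtual node
  reached from the root of \<open>t\<close> along the path \<open>p\<close>, where \<^const>\<open>False\<close> means left
  and \<^const>\<open>True\<close> means right.
\<close>

fun node_weight :: "'a tree \<Rightarrow> bool list \<Rightarrow> real" where
  "node_weight Leaf p = 1 / 2 ^ length p"
| "node_weight (Node l x r) [] = real (size1 (Node l x r))"
| "node_weight (Node l x r) (b # p) = node_weight (if b then r else l) p"

definition bal_C :: "'a tree \<Rightarrow> real" where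
  "bal_C t = Max {node_weight t [False], node_weight t [True]} / node_weight t []"

definition bal_GC :: "'a tree \<Rightarrow> real" where
  "bal_GC t =
     Max {node_weight t [False, False], node_weight t [False, True],
          node_weight t [True, False], node_weight t [True, True]} / node_weight t []"

definition balanced_node :: "real \<Rightarrow> real \<Rightarrow> 'a tree \<Rightarrow> bool" where
  "balanced_node \<alpha> \<beta> t \<longleftrightarrow> bal_C t \<le> \<alpha> \<and> bal_GC t \<le> \<beta>"

text \<open>The nodes of a tree are identified with its non-empty sub-trees.\<close>

definition grandchildren_balanced :: "real \<Rightarrow> real \<Rightarrow> 'a tree \<Rightarrow> bool" where
  "grandchildren_balanced \<alpha> \<beta> t \<longleftrightarrow> (\<forall>s \<in> subtrees t - {Leaf}. balanced_node \<alpha> \<beta> s)"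

text \<open>The depths of all empty sub-trees, from left to right and with repetitions.\<close>

fun leaf_depths :: "'a tree \<Rightarrow> nat list" where
  "leaf_depths Leaf = [0]"
| "leaf_depths (Node l x r) = map Suc (leaf_depths l @ leaf_depths r)"

definition external_path_length :: "'a tree \<Rightarrow> nat" where
  "external_path_length t = sum_list (leaf_depths t)"

definition balance_domain :: "(real \<times> real) set" where
  "balance_domain =
     {(\<alpha>, \<beta>). \<alpha> / 2 \<le> \<beta> \<and> \<beta> \<le> \<alpha>\<^sup>2 \<and> 1 / 2 \<le> \<alpha> \<and> \<alpha> \<le> 1} - {(1, 1)}"

text \<open>
  Since \<open>log 2 0 = 0\<close>, the usual convention \<open>0 * log 2 0 = 0\<close> holds, whence \<open>H2 0 = H2 1 = 0\<close>.
\<close>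

definition H2 :: "real \<Rightarrow> real" where
  "H2 x = - x * log 2 x - (1 - x) * log 2 (1 - x)"

definition balance_\<Delta> :: "real \<Rightarrow> real \<Rightarrow> real" where
  "balance_\<Delta> \<alpha> \<beta> = (H2 \<alpha> + \<alpha> * H2 (\<beta> / \<alpha>)) / (1 + \<alpha>)"

end

theory Submission
  imports Defs "HOL-Analysis.Convex"
begin

text \<open>
  With \<open>W\<close> the weight of the tree, \<open>\<lambda>\<close> is the sum of the weights of all nodes, and \<open>W log\<^sub>2 W\<close> is the
  sum over all nodes \<open>n\<close> of \<open>|n| H\<^sub>2(|n\<^sub>1|/|n|)\<close>; so one must show that the entropy of the splits is
  at least \<open>\<Delta>\<close> on average. Let \<open>x \<ge> 1/2\<close> be the relative weight of the heavier child of a node. If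
  \<open>x \<le> sqrt \<beta>\<close>, then \<open>H\<^sub>2(x) \<ge> H\<^sub>2(sqrt \<beta>) \<ge> \<Delta>\<close>. Otherwise the node is grouped with its heavier
  child: since no grandchild has relative weight above \<open>\<beta>\<close>, the two splits together contribute at
  least \<open>H\<^sub>2(x) + x H\<^sub>2(\<beta>/x)\<close>. This is the entropy of \<open>(\<beta>, x - \<beta>, 1 - x)\<close>, hence is concave in \<open>x\<close>,
  and it dominates the affine function \<open>(1 + x) \<Delta>\<close> on \<open>[sqrt \<beta>, \<alpha>]\<close> because it does so at both
  endpoints.
\<close>

section \<open>Convexity of \<open>x * log 2 x\<close> and the binary entropy\<close>

definition plogp :: "real \<Rightarrow> real" where
  "plogp x = x * log 2 x"

text \<open>A convex function lies above its tangent at \<open>m\<close>; this is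
  \<open>ln z \<le> z - 1\<close> at \<open>z = m / a\<close>. Summed over two vectors of equal
  total mass, the terms \<open>(a - m) / ln 2\<close> cancel, which is Gibbs' inequality.\<close>

lemma plogp_ge_tangent:
  assumes "0 \<le> a" "0 < m"
  shows "plogp a \<ge> a * log 2 m + (a - m) / ln 2"
proof (cases "a = 0")
  case True
  then show ?thesis using assms by (simp add: plogp_def divide_nonpos_pos)
next
  case False
  have "ln (m / a) \<le> m / a - 1"
    using False assms by (intro ln_le_minus_one) simp
  then have "a * (ln m - ln a) \<le> a * (m / a - 1)"
    using False assms by (simp add: ln_div)
  also have "\<dots> = m - a"
    using False by (simp add: field_simps)
  finally have "(a * ln m + (a - m)) / ln 2 \<le> (a * ln a) / ln 2"
    by (intro divide_right_mono) (auto simp: algebra_simps)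
  then show ?thesis
    by (simp add: plogp_def log_def add_divide_distrib)
qed

text \<open>Average the tangent bounds at the mean \<open>m\<close>, where the linear corrections
  cancel. The tangent exists only for \<open>m > 0\<close>, so \<open>m = 0\<close> is
  separate.\<close>

lemma convex_on_plogp: "convex_on {0..} plogp"
proof (rule convex_onI)
  fix t x y :: real
  assume t: "0 < t" "t < 1" and xy: "x \<in> {0..}" "y \<in> {0..}"
  define m where "m = (1 - t) * x + t * y"
  have goal: "plogp m \<le> (1 - t) * plogp x + t * plogp y"
  proof (cases "m = 0")
    case True
    then have "(1 - t) * x = 0 \<and> t * y = 0"
      using t xy unfolding m_def by (subst (asm) add_nonneg_eq_0_iff) auto
    then show ?thesis using True t by (auto simp: plogp_def)
  next
    case False
    then have m: "0 < m" using t xy by (simp add: m_def order_less_le)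
    have "(1 - t) * (x * log 2 m + (x - m) / ln 2) + t * (y * log 2 m + (y - m) / ln 2)
        \<le> (1 - t) * plogp x + t * plogp y"
      using t xy m by (intro add_mono mult_left_mono plogp_ge_tangent) auto
    moreover have "(1 - t) * (x * log 2 m + (x - m) / ln 2) + t * (y * log 2 m + (y - m) / ln 2)
        = ((1 - t) * x + t * y) * log 2 m + ((1 - t) * x + t * y - m) / ln 2"
      by (simp add: field_simps)
    ultimately show ?thesis by (simp add: m_def[symmetric]) (simp add: plogp_def)
  qed
  then show "plogp ((1 - t) *\<^sub>R x + t *\<^sub>R y) \<le> (1 - t) * plogp x + t * plogp y"
    by (simp add: m_def)
qed simp

lemma H2_eq: "H2 x = - plogp x - plogp (1 - x)"
  by (simp add: H2_def plogp_def)

text \<open>Gibbs' inequality for \<open>(y, 1 - y)\<close> against \<open>(x, 1 - x)\<close>,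
  followed by \<open>log 2 (1 - x) \<le> log 2 x\<close>. It needs \<open>1 - x > 0\<close>, hence
  the case \<open>x = 1\<close>.\<close>

lemma H2_antimono:
  assumes "1 / 2 \<le> x" "x \<le> y" "y \<le> 1"
  shows "H2 y \<le> H2 x"
proof (cases "x = 1")
  case True
  then show ?thesis using assms by simp
next
  case False
  have "y * log 2 x + (y - x) / ln 2 \<le> plogp y"
    and "(1 - y) * log 2 (1 - x) + ((1 - y) - (1 - x)) / ln 2 \<le> plogp (1 - y)"
    using assms False by (intro plogp_ge_tangent; simp)+
  moreover have "((1 - y) - (1 - x)) / ln 2 = - ((y - x) / ln 2)"
    by (simp add: field_simps)
  ultimately have "H2 y \<le> - y * log 2 x - (1 - y) * log 2 (1 - x)"
    unfolding H2_eq by simp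
  also have "\<dots> = H2 x - (y - x) * (log 2 x - log 2 (1 - x))"
    by (simp add: H2_def algebra_simps)
  also have "\<dots> \<le> H2 x"
    using assms False by simp
  finally show ?thesis .
qed

lemma H2_nonneg:
  assumes "0 \<le> x" "x \<le> 1"
  shows "0 \<le> H2 x"
proof -
  have "plogp z \<le> 0" if "0 \<le> z" "z \<le> 1" for z
    using that by (cases "z = 0") (auto simp: plogp_def mult_nonneg_nonpos)
  from this[of x] this[of "1 - x"] show ?thesis
    using assms by (simp add: H2_eq)
qed

lemma H2_pos:
  assumes "0 < x" "x < 1"
  shows "0 < H2 x"
proof -
  have "plogp z < 0" if "0 < z" "z < 1" for z
    using that by (auto simp: plogp_def mult_pos_neg)
  from this[of x] this[of "1 - x"] show ?thesis
    using assms by (simp add: H2_eq)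
qed

text \<open>The chain rule of entropy for unnormalised weights: it turns bounds on the entropy of a
  split into bounds on \<open>plogp\<close> of the weights.\<close>

lemma plogp_split:
  assumes "0 < w" "0 < a" "a < w"
  shows "plogp w = plogp a + plogp (w - a) + w * H2 (a / w)"
proof -
  have "w - a > 0" using assms by simp
  moreover have "1 - a / w = (w - a) / w" using assms by (simp add: field_simps)
  ultimately show ?thesis
    using assms by (simp add: H2_def plogp_def log_divide field_simps)
qed

text \<open>Applying \<open>plogp_split\<close> to \<open>x\<close> leaves \<open>x\<close> only in
  affine arguments of \<open>plogp\<close>, so that concavity in \<open>x\<close> can be read
  off.\<close>

lemma H2_chain:
  assumes "0 < b" "b < x"
  shows "H2 x + x * H2 (b / x) = - plogp b - plogp (x - b) - plogp (1 - x)"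
  using plogp_split[of x b] assms by (simp add: H2_eq)

section \<open>The parameter domain, and entropies bounded below by multiples of
  \<open>balance_\<Delta>\<close>\<close>

lemma balance_domainD:
  assumes "(\<alpha>, \<beta>) \<in> balance_domain"
  shows "1 / 2 \<le> \<alpha>" "\<alpha> \<le> 1" "1 / 4 \<le> \<beta>" "\<alpha> / 2 \<le> \<beta>" "\<beta> < 1" "\<beta> < \<alpha>"
    "1 / 2 \<le> sqrt \<beta>" "sqrt \<beta> < 1" "sqrt \<beta> \<le> \<alpha>" "\<beta> < sqrt \<beta>"
proof -
  have *: "\<alpha> / 2 \<le> \<beta>" "\<beta> \<le> \<alpha>\<^sup>2" "1 / 2 \<le> \<alpha>" "\<alpha> \<le> 1" "\<alpha> \<noteq> 1 \<or> \<beta> \<noteq> 1"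
    using assms by (auto simp: balance_domain_def)
  show "1 / 2 \<le> \<alpha>" "\<alpha> \<le> 1" "1 / 4 \<le> \<beta>" "\<alpha> / 2 \<le> \<beta>" using * by auto
  \<comment> \<open>In the chain \<beta> \<le> \<open>\<alpha>\<^sup>2\<close> \<le> \<alpha> \<le>
    1, the value \<beta> = 1 would force the excluded point (1, 1).\<close>
  have "\<alpha>\<^sup>2 \<le> \<alpha>" using * by (simp add: power2_eq_square mult_left_le)
  then show b1: "\<beta> < 1" using * by auto
  have s: "sqrt \<beta> * sqrt \<beta> = \<beta>" using * by simp
  show "1 / 2 \<le> sqrt \<beta>" using * by (intro real_le_rsqrt) (auto simp: power2_eq_square)
  show s1: "sqrt \<beta> < 1" using b1 by simp
  show sa: "sqrt \<beta> \<le> \<alpha>" using * by (intro real_le_lsqrt) auto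
  have "sqrt \<beta> > 0" using * by simp
  then have "sqrt \<beta> * sqrt \<beta> < sqrt \<beta> * 1" using s1 by (intro mult_strict_left_mono) auto
  then show "\<beta> < sqrt \<beta>" using s by simp
  then show "\<beta> < \<alpha>" using sa by simp
qed

lemma balance_\<Delta>_eq:
  assumes "(\<alpha>, \<beta>) \<in> balance_domain"
  shows "(1 + \<alpha>) * balance_\<Delta> \<alpha> \<beta> = H2 \<alpha> + \<alpha> * H2 (\<beta> / \<alpha>)"
  using balance_domainD[OF assms] by (simp add: balance_\<Delta>_def)

text \<open>Strictness comes from the second entropy, as \<open>\<beta> / \<alpha>\<close> is
  strictly between 0 and 1; \<open>H2 \<alpha>\<close> vanishes at \<alpha> = 1.\<close>

lemma balance_\<Delta>_pos:
  assumes "(\<alpha>, \<beta>) \<in> balance_domain"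
  shows "0 < balance_\<Delta> \<alpha> \<beta>"
proof -
  note d = balance_domainD[OF assms]
  have "0 < H2 (\<beta> / \<alpha>)" using d by (intro H2_pos) auto
  moreover have "0 \<le> H2 \<alpha>" using d by (intro H2_nonneg) auto
  ultimately show ?thesis using d by (simp add: balance_\<Delta>_def add_nonneg_pos)
qed

text \<open>
  Gibbs' inequality compares \<open>(\<beta>, \<alpha> - \<beta>, 1 - \<alpha>)\<close> with \<open>(s\<^sup>2, s (1 - s), 1 - s)\<close>, where \<open>s = sqrt \<beta>\<close>;
  the logarithms of the latter are combinations of \<open>log\<^sub>2 s\<close> and \<open>log\<^sub>2 (1 - s)\<close>.
\<close>

lemma balance_\<Delta>_le_H2_sqrt:
  assumes "(\<alpha>, \<beta>) \<in> balance_domain"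
  shows "balance_\<Delta> \<alpha> \<beta> \<le> H2 (sqrt \<beta>)"
proof -
  note d = balance_domainD[OF assms]
  define s where "s = sqrt \<beta>"
  have s: "1 / 2 \<le> s" "s < 1" "s \<le> \<alpha>" and b: "\<beta> = s * s"
    using d by (auto simp: s_def)
  define p q where "p = log 2 s" and "q = log 2 (1 - s)"
  have ss: "s * (1 - s) > 0" using s by simp
  have "plogp \<beta> = \<beta> * (2 * p)"
    using s by (simp add: plogp_def b p_def log_mult)
  moreover have "plogp (\<alpha> - \<beta>) \<ge> (\<alpha> - \<beta>) * (p + q) + ((\<alpha> - \<beta>) - s * (1 - s)) / ln 2"
    using plogp_ge_tangent[of "\<alpha> - \<beta>" "s * (1 - s)"] s d ss
    by (simp add: log_mult p_def q_def)
  moreover have "plogp (1 - \<alpha>) \<ge> (1 - \<alpha>) * q + ((1 - \<alpha>) - (1 - s)) / ln 2"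
    using plogp_ge_tangent[of "1 - \<alpha>" "1 - s"] s d by (simp add: q_def)
  \<comment> \<open>Both triples have mass 1 and share the entry \<beta>, so the linear terms
    cancel.\<close>
  moreover have "((\<alpha> - \<beta>) - s * (1 - s)) / ln 2 + ((1 - \<alpha>) - (1 - s)) / ln 2 = 0"
    by (simp add: b field_simps)
  ultimately have "H2 \<alpha> + \<alpha> * H2 (\<beta> / \<alpha>) \<le> - (\<beta> * (2 * p)) - (\<alpha> - \<beta>) * (p + q) - (1 - \<alpha>) * q"
    using d by (subst H2_chain) auto
  \<comment> \<open>The subtracted product is nonnegative: \<open>s \<le> \<alpha>\<close>, and
    \<open>p \<ge> q\<close> because \<open>s \<ge> 1 / 2\<close>.\<close>
  also have "\<dots> = (1 + \<alpha>) * (- s * p - (1 - s) * q) - ((1 - s) * (\<alpha> - s)) * (p - q)"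
    by (simp add: b algebra_simps)
  also have "\<dots> \<le> (1 + \<alpha>) * (- s * p - (1 - s) * q)"
    using s by (simp add: p_def q_def)
  also have "\<dots> = (1 + \<alpha>) * H2 s"
    by (simp add: H2_def p_def q_def)
  finally show ?thesis
    using d unfolding balance_\<Delta>_eq[OF assms, symmetric] s_def by simp
qed

lemma balance_\<Delta>_le_H2_chain:
  assumes "(\<alpha>, \<beta>) \<in> balance_domain" "sqrt \<beta> \<le> x" "x \<le> \<alpha>"
  shows "(1 + x) * balance_\<Delta> \<alpha> \<beta> \<le> H2 x + x * H2 (\<beta> / x)"
proof -
  note d = balance_domainD[OF assms(1)]
  define D where "D = balance_\<Delta> \<alpha> \<beta>"
  define s where "s = sqrt \<beta>"
  define f where "f = (\<lambda>x. H2 x + x * H2 (\<beta> / x))"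
  have f: "f z = - plogp \<beta> - plogp (z - \<beta>) - plogp (1 - z)" if "s \<le> z" for z
    using that d H2_chain[of \<beta> z] by (simp add: f_def s_def)
  have fa: "f \<alpha> = (1 + \<alpha>) * D"
    using balance_\<Delta>_eq[OF assms(1)] by (simp add: f_def D_def)
  \<comment> \<open>At the left endpoint both splits have the same ratio \<open>s\<close>, so
    \<open>f s\<close> reduces to the bound on \<open>H2 (sqrt \<beta>)\<close>.\<close>
  have "\<beta> / s = s" using d by (simp add: s_def real_div_sqrt)
  then have "f s = (1 + s) * H2 s"
    by (simp add: f_def algebra_simps)
  then have fs: "f s \<ge> (1 + s) * D"
    using balance_\<Delta>_le_H2_sqrt[OF assms(1)] d by (simp add: D_def s_def)
  show ?thesis
  proof (cases "s = \<alpha>")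
    case True
    then show ?thesis using fa assms by (simp add: s_def D_def f_def)
  next
    case False
    then have sa: "s < \<alpha>" using d by (simp add: s_def)
    \<comment> \<open>The coefficient of \<open>x\<close> as a convex combination of the endpoints
      \<open>s\<close> and \<alpha>.\<close>
    define t where "t = (x - s) / (\<alpha> - s)"
    have t: "0 \<le> t" "t \<le> 1" using assms sa by (auto simp: t_def s_def)
    have "t * (\<alpha> - s) = x - s" using sa by (simp add: t_def)
    then have x: "x = (1 - t) * s + t * \<alpha>" by (simp add: algebra_simps)
    have "plogp ((1 - t) *\<^sub>R (s - \<beta>) + t *\<^sub>R (\<alpha> - \<beta>))
        \<le> (1 - t) * plogp (s - \<beta>) + t * plogp (\<alpha> - \<beta>)"
      using t d by (intro convex_onD[OF convex_on_plogp]) (auto simp: s_def)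
    moreover have "(1 - t) *\<^sub>R (s - \<beta>) + t *\<^sub>R (\<alpha> - \<beta>) = x - \<beta>"
      by (simp add: x algebra_simps)
    moreover have "plogp ((1 - t) *\<^sub>R (1 - s) + t *\<^sub>R (1 - \<alpha>))
        \<le> (1 - t) * plogp (1 - s) + t * plogp (1 - \<alpha>)"
      using t d by (intro convex_onD[OF convex_on_plogp]) (auto simp: s_def)
    moreover have "(1 - t) *\<^sub>R (1 - s) + t *\<^sub>R (1 - \<alpha>) = 1 - x"
      by (simp add: x algebra_simps)
    ultimately have "(1 - t) * f s + t * f \<alpha> \<le> f x"
      using sa assms(2) by (simp add: f s_def[symmetric]) (simp add: algebra_simps)
    moreover have "(1 - t) * ((1 + s) * D) + t * ((1 + \<alpha>) * D) \<le> (1 - t) * f s + t * f \<alpha>"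
      using t fs fa by (intro add_mono mult_left_mono) auto
    moreover have "(1 - t) * ((1 + s) * D) + t * ((1 + \<alpha>) * D) = (1 + x) * D"
      by (simp add: x algebra_simps)
    ultimately show ?thesis by (simp add: f_def D_def)
  qed
qed

text \<open>Here \<open>y\<close> is the share of the heavier grandchild within the heavy child.
  Since \<open>1 / 2 \<le> y \<le> \<beta> / x \<le> 1\<close>, replacing \<open>y\<close> by
  \<open>\<beta> / x\<close> only lowers the entropy.\<close>

lemma balance_\<Delta>_le_H2_plus_child:
  assumes "(\<alpha>, \<beta>) \<in> balance_domain" "sqrt \<beta> \<le> x" "x \<le> \<alpha>" "1 / 2 \<le> y" "x * y \<le> \<beta>"
  shows "(1 + x) * balance_\<Delta> \<alpha> \<beta> \<le> H2 x + x * H2 y"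
proof -
  note d = balance_domainD[OF assms(1)]
  have x: "x > 0" "\<beta> \<le> x" using d assms(2) by auto
  have "H2 (\<beta> / x) \<le> H2 y"
    using assms x by (intro H2_antimono) (auto simp: field_simps)
  then have "x * H2 (\<beta> / x) \<le> x * H2 y"
    using x by (intro mult_left_mono) auto
  then show ?thesis using balance_\<Delta>_le_H2_chain[OF assms(1-3)] by linarith
qed

section \<open>The entropy bounds scaled to the weights of one split or of two nested splits\<close>

lemma plogp_one_step:
  assumes "(\<alpha>, \<beta>) \<in> balance_domain" "0 < b" "b \<le> a" "a \<le> sqrt \<beta> * (a + b)"
  shows "plogp a + plogp b + balance_\<Delta> \<alpha> \<beta> * (a + b) \<le> plogp (a + b)"
proof -
  note d = balance_domainD[OF assms(1)]
  have "balance_\<Delta> \<alpha> \<beta> \<le> H2 (sqrt \<beta>)" by (rule balance_\<Delta>_le_H2_sqrt[OF assms(1)])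
  \<comment> \<open>The heavier share \<open>a / (a + b)\<close> lies between 1/2 and
    \<open>sqrt \<beta>\<close>.\<close>
  also have "\<dots> \<le> H2 (a / (a + b))"
    using assms d by (intro H2_antimono) (auto simp: field_simps)
  finally have "(a + b) * balance_\<Delta> \<alpha> \<beta> \<le> (a + b) * H2 (a / (a + b))"
    using assms by (intro mult_left_mono) auto
  then show ?thesis
    using plogp_split[of "a + b" a] assms by (simp add: mult.commute)
qed

lemma plogp_two_steps:
  assumes "(\<alpha>, \<beta>) \<in> balance_domain" "0 < b" "0 < a2" "a2 \<le> a1"
    and "sqrt \<beta> * (a1 + a2 + b) \<le> a1 + a2" "a1 + a2 \<le> \<alpha> * (a1 + a2 + b)"
    and "a1 \<le> \<beta> * (a1 + a2 + b)"
  shows "plogp a1 + plogp a2 + plogp b + balance_\<Delta> \<alpha> \<beta> * (a1 + a2 + (a1 + a2 + b))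
    \<le> plogp (a1 + a2 + b)"
proof -
  define a w where "a = a1 + a2" and "w = a1 + a2 + b"
  define x y where "x = a / w" and "y = a1 / a"
  have pos: "0 < a" "0 < w" "a < w" using assms by (auto simp: a_def w_def)
  have "(1 + x) * balance_\<Delta> \<alpha> \<beta> \<le> H2 x + x * H2 y"
  proof (rule balance_\<Delta>_le_H2_plus_child[OF assms(1)])
    show "sqrt \<beta> \<le> x" "x \<le> \<alpha>"
      using assms(5,6)[folded w_def, folded a_def] pos by (auto simp: x_def field_simps)
    show "1 / 2 \<le> y" using assms pos by (simp add: y_def field_simps) (simp add: a_def)
    show "x * y \<le> \<beta>" using assms(7)[folded w_def] pos by (simp add: x_def y_def field_simps)
  qed
  then have "w * ((1 + x) * balance_\<Delta> \<alpha> \<beta>) \<le> w * (H2 x + x * H2 y)"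
    using pos by (intro mult_left_mono) auto
  moreover have "w * x = a" using pos by (simp add: x_def)
  ultimately have "balance_\<Delta> \<alpha> \<beta> * (a + w) \<le> w * H2 x + a * H2 y"
    by (simp add: algebra_simps) (simp add: mult.assoc[symmetric])
  moreover have "plogp w = plogp a + plogp (w - a) + w * H2 x"
    unfolding x_def using pos by (intro plogp_split) auto
  moreover have "plogp a = plogp a1 + plogp (a - a1) + a * H2 y"
    unfolding y_def using pos assms by (intro plogp_split) (auto simp: a_def)
  moreover have "w - a = b" "a - a1 = a2" by (auto simp: a_def w_def)
  ultimately show ?thesis unfolding w_def[symmetric] unfolding a_def[symmetric] by simp
qed

section \<open>Path lengths and balance conditions of trees\<close>

lemma length_leaf_depths: "length (leaf_depths t) = size1 t"
  by (induction t) auto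

lemma external_path_length_simps [simp]:
  "external_path_length Leaf = 0"
  "external_path_length (Node l x r) =
     external_path_length l + external_path_length r + (size1 l + size1 r)"
proof -
  have "sum_list (map Suc xs) = sum_list xs + length xs" for xs
    by (induction xs) auto
  then show "external_path_length (Node l x r) =
     external_path_length l + external_path_length r + (size1 l + size1 r)"
    by (simp add: external_path_length_def length_leaf_depths)
qed (simp add: external_path_length_def)

lemma node_weight_Nil [simp]: "node_weight t [] = real (size1 t)"
  by (cases t) auto

lemma balanced_nodeD:
  assumes "balanced_node \<alpha> \<beta> (Node l x r)"
  shows "size1 l \<le> \<alpha> * (real (size1 l) + size1 r)" "size1 r \<le> \<alpha> * (real (size1 l) + size1 r)"
    and "l = Node l1 y l2 \<Longrightarrow> size1 l1 \<le> \<beta> * (real (size1 l) + size1 r)"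
    and "l = Node l1 y l2 \<Longrightarrow> size1 l2 \<le> \<beta> * (real (size1 l) + size1 r)"
    and "r = Node r1 z r2 \<Longrightarrow> size1 r1 \<le> \<beta> * (real (size1 l) + size1 r)"
    and "r = Node r1 z r2 \<Longrightarrow> size1 r2 \<le> \<beta> * (real (size1 l) + size1 r)"
proof -
  have w: "0 < real (size1 l) + size1 r" by (simp add: size1_size)
  show "size1 l \<le> \<alpha> * (real (size1 l) + size1 r)" "size1 r \<le> \<alpha> * (real (size1 l) + size1 r)"
    using assms w by (auto simp: balanced_node_def bal_C_def pos_divide_le_eq simp del: size1_size)
  show "l = Node l1 y l2 \<Longrightarrow> size1 l1 \<le> \<beta> * (real (size1 l) + size1 r)"
    "l = Node l1 y l2 \<Longrightarrow> size1 l2 \<le> \<beta> * (real (size1 l) + size1 r)"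
    "r = Node r1 z r2 \<Longrightarrow> size1 r1 \<le> \<beta> * (real (size1 l) + size1 r)"
    "r = Node r1 z r2 \<Longrightarrow> size1 r2 \<le> \<beta> * (real (size1 l) + size1 r)"
    using assms w by (auto simp: balanced_node_def bal_GC_def pos_divide_le_eq)
qed

lemma grandchildren_balanced_Node:
  "grandchildren_balanced \<alpha> \<beta> (Node l x r) \<longleftrightarrow>
     balanced_node \<alpha> \<beta> (Node l x r) \<and> grandchildren_balanced \<alpha> \<beta> l \<and> grandchildren_balanced \<alpha> \<beta> r"
  by (auto simp: grandchildren_balanced_def)

text \<open>The induction step with the heavier child on the left. If that child exceeds
  \<open>sqrt \<beta> * w\<close>, it is merged with the root and the bound is taken at its two
  children and at \<open>r\<close>; hence \<open>ok\<close> is assumed at grandchildren too.\<close>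

lemma external_path_length_step:
  fixes l r :: "'a tree" and \<alpha> \<beta> w :: real
  defines "w \<equiv> real (size1 l) + size1 r"
  defines "ok \<equiv> \<lambda>t :: 'a tree. balance_\<Delta> \<alpha> \<beta> * external_path_length t \<le> plogp (size1 t)"
  assumes dom: "(\<alpha>, \<beta>) \<in> balance_domain"
    and heavy: "size1 r \<le> size1 l" and children: "size1 l \<le> \<alpha> * w" and ok: "ok l" "ok r"
    and grandchildren: "\<And>l1 x l2. l = Node l1 x l2 \<Longrightarrow>
      size1 l1 \<le> \<beta> * w \<and> size1 l2 \<le> \<beta> * w \<and> ok l1 \<and> ok l2"
  shows "balance_\<Delta> \<alpha> \<beta> * (external_path_length l + external_path_length r + w) \<le> plogp w"
proof (cases "size1 l \<le> sqrt \<beta> * w")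
  case True
  have "plogp (size1 l) + plogp (size1 r) + balance_\<Delta> \<alpha> \<beta> * w \<le> plogp w"
    using True heavy dom unfolding w_def by (intro plogp_one_step) (auto simp: size1_size)
  then show ?thesis using ok by (simp add: ok_def algebra_simps)
next
  case False
  note d = balance_domainD[OF dom]
  show ?thesis
  proof (cases l)
    \<comment> \<open>Both children then have weight 1, so the share of \<open>l\<close> is 1/2
      \<le> \<open>sqrt \<beta>\<close>, contradicting the case assumption.\<close>
    case Leaf
    then have "size1 r = 1" using heavy by (simp add: size1_size)
    then show ?thesis using False Leaf d by (simp add: w_def)
  next
    case (Node l1 y l2)
    \<comment> \<open>\<open>plogp_two_steps\<close> expects the heavier grandchild first.\<close>
    define u v where "u = max (real (size1 l1)) (size1 l2)" and "v = min (real (size1 l1)) (size1 l2)"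
    have uv: "u + v = size1 l" "plogp u + plogp v = plogp (size1 l1) + plogp (size1 l2)"
      using Node by (auto simp: u_def v_def max_def min_def)
    have "plogp u + plogp v + plogp (size1 r) + balance_\<Delta> \<alpha> \<beta> * (u + v + (u + v + size1 r))
        \<le> plogp (u + v + size1 r)"
    proof (rule plogp_two_steps[OF dom])
      show "0 < v" "0 < real (size1 r)" "v \<le> u" by (auto simp: u_def v_def size1_size)
      show "sqrt \<beta> * (u + v + size1 r) \<le> u + v" "u + v \<le> \<alpha> * (u + v + size1 r)"
        using False children by (auto simp: uv w_def)
      show "u \<le> \<beta> * (u + v + size1 r)"
        using grandchildren[OF Node] by (simp add: uv(1) w_def) (simp add: u_def)
    qed
    then have "plogp (size1 l1) + plogp (size1 l2) + plogp (size1 r)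
        + balance_\<Delta> \<alpha> \<beta> * (size1 l + w) \<le> plogp w"
      by (simp only: uv w_def)
    \<comment> \<open>Unfolding \<open>l\<close> charges \<open>size1 l\<close> for the merged
      child, on top of \<open>w\<close> for the root.\<close>
    moreover have "balance_\<Delta> \<alpha> \<beta> * (external_path_length l + external_path_length r + w)
        = balance_\<Delta> \<alpha> \<beta> * external_path_length l1 + balance_\<Delta> \<alpha> \<beta> * external_path_length l2
        + balance_\<Delta> \<alpha> \<beta> * external_path_length r + balance_\<Delta> \<alpha> \<beta> * (size1 l + w)"
      using Node by (simp add: algebra_simps)
    ultimately show ?thesis using grandchildren[OF Node] ok unfolding ok_def by linarith
  qed
qed

lemma balance_\<Delta>_mult_external_path_length_le:
  assumes "(\<alpha>, \<beta>) \<in> balance_domain" "grandchildren_balanced \<alpha> \<beta> t"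
  shows "balance_\<Delta> \<alpha> \<beta> * external_path_length t \<le> plogp (size1 t)"
  using assms(2)
\<comment> \<open>Induction on the size makes the hypothesis available at grandchildren.\<close>
proof (induction t rule: measure_induct_rule[where f = size])
  case (less t)
  show ?case
  proof (cases t)
    case Leaf
    then show ?thesis by (simp add: plogp_def)
  next
    case (Node l x r)
    have bal: "balanced_node \<alpha> \<beta> (Node l x r)" "grandchildren_balanced \<alpha> \<beta> l"
      "grandchildren_balanced \<alpha> \<beta> r"
      using less.prems Node by (auto simp: grandchildren_balanced_Node)
    note b = balanced_nodeD[OF bal(1)]
    have ok: "balance_\<Delta> \<alpha> \<beta> * external_path_length s \<le> plogp (size1 s)"
      if "grandchildren_balanced \<alpha> \<beta> s" "size s < size t" for s :: "'a tree"
      using less.IH that by blast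
    have okl: "balance_\<Delta> \<alpha> \<beta> * external_path_length l \<le> plogp (size1 l)"
      and okr: "balance_\<Delta> \<alpha> \<beta> * external_path_length r \<le> plogp (size1 r)"
      using bal Node by (auto intro!: ok)
    show ?thesis
    proof (cases "size1 r \<le> size1 l")
      case True
      have "balance_\<Delta> \<alpha> \<beta> * (external_path_length l + external_path_length r
          + (real (size1 l) + size1 r)) \<le> plogp (real (size1 l) + size1 r)"
      proof (rule external_path_length_step[OF assms(1) True b(1) okl okr])
        fix l1 y l2 assume l: "l = Node l1 y l2"
        show "size1 l1 \<le> \<beta> * (real (size1 l) + size1 r) \<and> size1 l2 \<le> \<beta> * (real (size1 l) + size1 r)
          \<and> balance_\<Delta> \<alpha> \<beta> * external_path_length l1 \<le> plogp (size1 l1)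
          \<and> balance_\<Delta> \<alpha> \<beta> * external_path_length l2 \<le> plogp (size1 l2)"
          using b(3)[OF l] b(4)[OF l] bal(2) Node
          by (auto intro!: ok simp: l grandchildren_balanced_Node)
      qed
      then show ?thesis using Node by simp
    next
      \<comment> \<open>The mirror image: the same step with \<open>l\<close> and \<open>r\<close>
        exchanged.\<close>
      case False
      then have le: "size1 l \<le> size1 r" by simp
      have "balance_\<Delta> \<alpha> \<beta> * (external_path_length r + external_path_length l
          + (real (size1 r) + size1 l)) \<le> plogp (real (size1 r) + size1 l)"
      proof (rule external_path_length_step[OF assms(1) le _ okr okl])
        show "size1 r \<le> \<alpha> * (real (size1 r) + size1 l)" using b(2) by (simp add: add.commute)
        fix r1 y r2 assume r: "r = Node r1 y r2"
        show "size1 r1 \<le> \<beta> * (real (size1 r) + size1 l) \<and> size1 r2 \<le> \<beta> * (real (size1 r) + size1 l)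
          \<and> balance_\<Delta> \<alpha> \<beta> * external_path_length r1 \<le> plogp (size1 r1)
          \<and> balance_\<Delta> \<alpha> \<beta> * external_path_length r2 \<le> plogp (size1 r2)"
          using b(5)[OF r] b(6)[OF r] bal(3) Node
          by (auto intro!: ok simp: r grandchildren_balanced_Node add_ac)
      qed
      then show ?thesis using Node by (simp add: add_ac)
    qed
  qed
qed

theorem theorem2:
  fixes \<alpha> \<beta> :: real and t :: "'a tree" and N :: nat
  assumes "(\<alpha>, \<beta>) \<in> balance_domain"
    and "grandchildren_balanced \<alpha> \<beta> t"
    and "size t = N"
  shows "real (external_path_length t) \<le> (real N + 1) * log 2 (real N + 1) / balance_\<Delta> \<alpha> \<beta>"
proof -
  have "real (size1 t) = real N + 1" using assms(3) by (simp add: size1_size)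
  then show ?thesis
    using balance_\<Delta>_mult_external_path_length_le[OF assms(1,2)] balance_\<Delta>_pos[OF assms(1)]
    by (simp add: plogp_def pos_le_divide_eq mult.commute)
qed

end
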